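(* Let $T$ be a tree with $\alpha(T)=\alpha$. Then $$s_{\lceil(2\alpha-1)/3\rceil}\geq\cdots\geq s_{\alpha-1}\geq s_{\alpha},$$ i.e. $s_k\geq s_{k+1}$ for every integer $k$ with $\lceil(2\alpha-1)/3\rceil\leq k<\alpha$.
   Context: All graphs are finite, undirected, without loops or multiple edges. A tree is an acyclic connected graph. A stable set is a set of pairwise non-adjacent vertices (the empty set is stable). The stability number $\alpha(T)$ is the maximum cardinality of a stable set in $T$, and $s_k$ denotes the number of stable sets of cardinality $k$ in $T$, for $0\leq k\leq\alpha(T)$. *)

theory Defs
  imports Complex_Main "Graph_Theory.Digraph_Component"
begin

text \<open>
  A finite simple undirected graph is a \<^locale>\<open>graph\<close>: a finite symmetric digraph without
  loops or parallel arcs, each edge being a pair of opposite arcs.  The library predicates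
  \<^const>\<open>forest\<close> and \<^const>\<open>tree\<close> are not usable here, since they regard a pair of opposite
  arcs as a (directed) cycle of length 2.  The cycles of the undirected graph are the
  directed cycles of length at least 3.
\<close>

definition undirected_acyclic :: "('a, 'b) pre_digraph \<Rightarrow> bool" where
  "undirected_acyclic G \<longleftrightarrow> \<not> (\<exists>p. pre_digraph.cycle G p \<and> 3 \<le> length p)"

text \<open>The library's connectedness of graphs, not the topological notion; it requires a
  nonempty vertex set.\<close>

definition undirected_tree :: "('a, 'b) pre_digraph \<Rightarrow> bool" where
  "undirected_tree G \<longleftrightarrow> graph G \<and> Digraph_Component.connected G \<and> undirected_acyclic G"

definition stable_set :: "('a, 'b) pre_digraph \<Rightarrow> 'a set \<Rightarrow> bool" where
  "stable_set G S \<longleftrightarrow> S \<subseteq> verts G \<and> pairwise (\<lambda>u v. \<not> u \<rightarrow>\<^bsub>G\<^esub> v) S"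

definition stability_number :: "('a, 'b) pre_digraph \<Rightarrow> nat" where
  "stability_number G = Max {card S | S. stable_set G S}"

definition num_stable_sets :: "('a, 'b) pre_digraph \<Rightarrow> nat \<Rightarrow> nat" where
  "num_stable_sets G k = card {S. stable_set G S \<and> card S = k}"

end

theory Submission
  imports Defs
begin

text \<open>
  If \<open>A\<close> is a stable set of size \<open>k\<close> in a bipartite graph, then each colour class meets the set of
  vertices that can be added to \<open>A\<close> in at most \<open>\<alpha> - k\<close> points, because adding all of them at once
  to \<open>A\<close> leaves it stable.  Double counting the pairs \<open>A \<subset> B\<close> of stable sets of sizes \<open>k\<close> and
  \<open>k + 1\<close> thus gives \<open>(k + 1) s\<^bsub>k+1\<^esub> \<le> 2 (\<alpha> - k) s\<^bsub>k\<^esub>\<close>, and \<open>2 (\<alpha> - k) \<le> k + 1\<close> in the stated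
  range.  A tree is bipartite: its vertices are coloured by the parity of the walks from a root,
  and an edge inside a colour class would close up to an odd walk, hence contain an odd cycle.
\<close>

lemma stable_set_mono: "stable_set G S \<Longrightarrow> S' \<subseteq> S \<Longrightarrow> stable_set G S'"
  unfolding stable_set_def by (auto intro: pairwise_subset)

lemma finite_stable_set: "finite (verts G) \<Longrightarrow> stable_set G S \<Longrightarrow> finite S"
  by (auto simp: stable_set_def intro: finite_subset)

lemma finite_stable_sets: "finite (verts G) \<Longrightarrow> finite {S. stable_set G S \<and> P S}"
  by (rule finite_subset[of _ "Pow (verts G)"]) (auto simp: stable_set_def)

lemma card_le_stability_number:
  assumes "finite (verts G)" "stable_set G S"
  shows "card S \<le> stability_number G"
proof -
  have "finite {card S | S. stable_set G S}"
    using finite_stable_sets[OF assms(1), of "\<lambda>_. True"] by (simp add: setcompr_eq_image)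
  then show ?thesis
    unfolding stability_number_def using assms(2) by (auto intro: Max_ge)
qed

definition stable_extensions :: "('a, 'b) pre_digraph \<Rightarrow> 'a set \<Rightarrow> 'a set" where
  "stable_extensions G A = {x. x \<notin> A \<and> stable_set G (insert x A)}"

lemma finite_stable_extensions: "finite (verts G) \<Longrightarrow> finite (stable_extensions G A)"
  by (rule finite_subset[of _ "verts G"]) (auto simp: stable_extensions_def stable_set_def)

lemma card_stable_extensions_Int_le:
  assumes fin: "finite (verts G)" and A: "stable_set G A" and X: "stable_set G X"
  shows "card (stable_extensions G A \<inter> X) \<le> stability_number G - card A"
proof -
  let ?W = "stable_extensions G A \<inter> X"
  \<comment> \<open>Two vertices of \<open>?W\<close> are non-adjacent because both lie in
    \<open>X\<close>; a vertex \<open>x\<close> of \<open>?W\<close> and one of \<open>A\<close>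
    are, because \<open>insert x A\<close> is stable.\<close>
  have "stable_set G (A \<union> ?W)"
    using A X unfolding stable_set_def stable_extensions_def pairwise_def by auto
  then have "card (A \<union> ?W) \<le> stability_number G"
    by (rule card_le_stability_number[OF fin])
  moreover have "card (A \<union> ?W) = card A + card ?W"
    using finite_stable_set[OF fin A] finite_stable_extensions[OF fin, of A]
    by (intro card_Un_disjoint) (auto simp: stable_extensions_def)
  ultimately show ?thesis by simp
qed

lemma card_stable_extensions_le:
  assumes fin: "finite (verts G)" and A: "stable_set G A"
    and X: "stable_set G X" and Y: "stable_set G Y" and cover: "verts G = X \<union> Y"
  shows "card (stable_extensions G A) \<le> 2 * (stability_number G - card A)"
proof -
  have "stable_extensions G A = (stable_extensions G A \<inter> X) \<union> (stable_extensions G A \<inter> Y)"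
    using cover by (auto simp: stable_extensions_def stable_set_def)
  then have "card (stable_extensions G A)
      \<le> card (stable_extensions G A \<inter> X) + card (stable_extensions G A \<inter> Y)"
    by (metis card_Un_le)
  then show ?thesis
    using card_stable_extensions_Int_le[OF fin A X] card_stable_extensions_Int_le[OF fin A Y]
    by simp
qed

lemma Suc_mult_num_stable_sets_le:
  assumes fin: "finite (verts G)"
    and X: "stable_set G X" and Y: "stable_set G Y" and cover: "verts G = X \<union> Y"
  shows "Suc k * num_stable_sets G (Suc k)
    \<le> 2 * (stability_number G - k) * num_stable_sets G k"
proof -
  let ?S = "\<lambda>k. {S. stable_set G S \<and> card S = k}"
  let ?P = "SIGMA B:?S (Suc k). B" and ?Q = "SIGMA A:?S k. stable_extensions G A"
  have finS: "finite (?S j)" for j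
    by (rule finite_stable_sets[OF fin])
  note fin_stable = finite_stable_set[OF fin]
  have "card ?P = (\<Sum>B\<in>?S (Suc k). card B)"
    by (rule card_SigmaI) (auto simp: finS fin_stable)
  then have P: "card ?P = Suc k * num_stable_sets G (Suc k)"
    by (simp add: num_stable_sets_def)
  have finQ: "finite ?Q"
    using finS finite_stable_extensions[OF fin] by (intro finite_SigmaI) auto
  have "card ?P \<le> card ?Q"
  \<comment> \<open>\<open>(B, x)\<close> and \<open>(B - {x}, x)\<close> record the same pair of
    nested stable sets, from above and from below; \<open>B\<close> is recovered by putting
    \<open>x\<close> back.\<close>
  proof (rule card_inj_on_le[OF _ _ finQ])
    show "inj_on (\<lambda>(B, x). (B - {x}, x)) ?P"
      by (auto simp: inj_on_def)
    show "(\<lambda>(B, x). (B - {x}, x)) ` ?P \<subseteq> ?Q"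
      by (auto simp: stable_extensions_def insert_absorb fin_stable intro: stable_set_mono)
  qed
  also have "card ?Q = (\<Sum>A\<in>?S k. card (stable_extensions G A))"
    by (rule card_SigmaI) (auto simp: finS finite_stable_extensions[OF fin])
  also have "\<dots> \<le> (\<Sum>A\<in>?S k. 2 * (stability_number G - k))"
    using card_stable_extensions_le[OF fin _ X Y cover] by (intro sum_mono) auto
  also have "\<dots> = 2 * (stability_number G - k) * num_stable_sets G k"
    by (simp add: num_stable_sets_def)
  finally show ?thesis using P by simp
qed

text \<open>At a repeated vertex the walk splits into two shorter closed walks. Their lengths add up
  to an odd number, so one of them is odd and the induction continues with it.\<close>

lemma (in wf_digraph) odd_closed_awalk_imp_odd_cycle:
  assumes "awalk u p u" "odd (length p)"
  shows "\<exists>c. cycle c \<and> odd (length c)"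
  using assms
proof (induction p arbitrary: u rule: length_induct)
  case (1 p)
  note IH = "1.IH" and p = "1.prems"
  obtain e es where e: "p = e # es" using p(2) by (cases p) auto
  show ?case
  \<comment> \<open>A closed walk lists \<open>u\<close> at both ends, so repetitions are sought
    only after the first entry is dropped. The arc \<open>e\<close> then stays outside the loop
    \<open>r\<close>, which makes \<open>r\<close> strictly shorter than \<open>p\<close>.\<close>
  proof (cases "distinct (tl (awalk_verts u p))")
    case True
    then show ?thesis using p e unfolding cycle_def by blast
  next
    case False
    have es: "e \<in> arcs G" "u = tail G e" "awalk (head G e) es u"
      using p(1) e by (auto simp: awalk_Cons_iff)
    have "\<not> distinct (awalk_verts (head G e) es)"
      using False e by simp
    from awalk_not_distinct_decomp[OF es(3) this] obtain q r s w
      where d: "es = q @ r @ s" "r \<noteq> []" "awalk (head G e) q w" "awalk w r w" "awalk w s u"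
      by blast
    show ?thesis
    proof (cases "odd (length r)")
      case True
      moreover have "length r < length p"
        using d(1) e by simp
      ultimately show ?thesis using IH d(4) by blast
    next
      case even: False
      have "awalk u (e # q @ s) u"
        using es d awalk_appendI by (auto simp: awalk_Cons_iff)
      moreover have "odd (length (e # q @ s))" "length (e # q @ s) < length p"
        using even p(2) d(1,2) e by auto
      ultimately show ?thesis using IH by blast
    qed
  qed
qed

lemma (in sym_digraph) reverse_awalk:
  assumes "awalk u p v"
  shows "\<exists>q. awalk v q u \<and> length q = length p"
  using assms
proof (induction p arbitrary: u)
  case Nil
  then show ?case by (auto simp: awalk_Nil_iff)
next
  case (Cons e es)
  then have e: "e \<in> arcs G" "u = tail G e" and "awalk (head G e) es v"
    by (auto simp: awalk_Cons_iff)
  then obtain q where q: "awalk v q (head G e)" "length q = length es"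
    using Cons.IH by blast
  obtain e' where "e' \<in> arcs G" "tail G e' = head G e" "head G e' = tail G e"
    using sym_arcs e(1) unfolding symmetric_conv by metis
  then have "awalk (head G e) [e'] u"
    using e arc_implies_awalk by metis
  then have "awalk v (q @ [e']) u"
    using q(1) awalk_appendI by blast
  then show ?case using q(2) by (metis length_append_singleton length_Cons)
qed

text \<open>Bridges the gap to \<open>undirected_acyclic\<close>, which tolerates the 2-cycles
  formed by opposite arcs: length 1 would be a loop, and length 2 is even.\<close>

lemma (in loopfree_digraph) odd_cycle_length_ge_3:
  assumes "cycle p" "odd (length p)"
  shows "3 \<le> length p"
proof -
  have "2 \<le> length p" using assms(1) unfolding cycle_digraph_conv by blast
  then show ?thesis using assms(2) by (cases "length p = 2") auto
qed

lemma undirected_tree_bipartite: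
  assumes "undirected_tree G"
  obtains X Y where "stable_set G X" "stable_set G Y" "verts G = X \<union> Y"
proof -
  interpret graph G using assms by (simp add: undirected_tree_def)
  \<comment> \<open>Since arcs come in opposite pairs, connectedness yields directed walks from a
    root to every vertex, and also a vertex to serve as root.\<close>
  have sc: "strongly_connected G"
    using assms symmetric_connected_imp_strongly_connected[OF sym_arcs]
    by (simp add: undirected_tree_def)
  then obtain r where "r \<in> verts G" by (auto simp: strongly_connected_def)
  let ?C = "\<lambda>b. {v \<in> verts G. \<exists>p. awalk r p v \<and> even (length p) = b}"
  have "stable_set G (?C b)" for b
    unfolding stable_set_def
  proof (intro conjI pairwiseI notI)
    fix u v assume "u \<in> ?C b" "v \<in> ?C b" "u \<rightarrow>\<^bsub>G\<^esub> v"
    then obtain p q e where p: "awalk r p u" "even (length p) = b"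
      and q: "awalk r q v" "even (length q) = b" and e: "awalk u [e] v"
      using arc_implies_awalk by (auto elim!: reachableE)
    \<comment> \<open>Go from \<open>r\<close> to \<open>u\<close>, cross the edge to
      \<open>v\<close>, and return along the reverse of \<open>q\<close>: two lengths of equal
      parity plus 1 give an odd closed walk.\<close>
    obtain q' where "awalk v q' r" "length q' = length q"
      using reverse_awalk[OF q(1)] by blast
    then have "awalk r (p @ [e] @ q') r" "odd (length (p @ [e] @ q'))"
      using p q e awalk_appendI by (blast, simp)
    then obtain c where "cycle c" "odd (length c)"
      using odd_closed_awalk_imp_odd_cycle by blast
    then show False
      using assms odd_cycle_length_ge_3 unfolding undirected_tree_def undirected_acyclic_def
      by blast
  qed auto
  moreover have "verts G = ?C True \<union> ?C False"
  proof -
    have "\<exists>p. awalk r p v" if "v \<in> verts G" for v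
      using sc \<open>r \<in> verts G\<close> that by (simp add: strongly_connected_def reachable_awalk)
    then show ?thesis by blast
  qed
  ultimately show thesis using that by blast
qed

theorem corollary2p8:
  fixes T :: "('a, 'b) pre_digraph" and \<alpha> k :: nat
  assumes "undirected_tree T"
    and "stability_number T = \<alpha>"
    and "\<lceil>(2 * real \<alpha> - 1) / 3\<rceil> \<le> int k"
    and "k < \<alpha>"
  shows "num_stable_sets T k \<ge> num_stable_sets T (k + 1)"
proof -
  interpret graph T using assms(1) by (simp add: undirected_tree_def)
  obtain X Y where XY: "stable_set T X" "stable_set T Y" "verts T = X \<union> Y"
    using undirected_tree_bipartite[OF assms(1)] .
  \<comment> \<open>The ceiling bound says exactly that the factor \<open>2 * (\<alpha> - k)\<close>
    has dropped to at most \<open>k + 1\<close>.\<close>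
  have "(2 * real \<alpha> - 1) / 3 \<le> real k"
    using assms(3) by (simp add: ceiling_le_iff)
  then have "2 * \<alpha> \<le> 3 * k + 1"
    by (simp add: field_simps)
  then have "2 * (\<alpha> - k) \<le> Suc k"
    by simp
  have "Suc k * num_stable_sets T (Suc k) \<le> 2 * (\<alpha> - k) * num_stable_sets T k"
    using Suc_mult_num_stable_sets_le[OF finite_verts XY] assms(2) by simp
  also have "\<dots> \<le> Suc k * num_stable_sets T k"
    using \<open>2 * (\<alpha> - k) \<le> Suc k\<close> by (rule mult_right_mono) simp
  finally show ?thesis unfolding Suc_mult_le_cancel1 by simp
qed

end
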